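(* In the $k$-armed bandit trading-prophet problem there exist online algorithms $\mathrm{ALG}_1$ and $\mathrm{ALG}_2$ such that for all instances $$\mathbb{E}(\mathrm{ALG}_1)\ge \frac{1}{16k}\,\mathbb{E}(\mathrm{OPT}),\qquad \mathbb{E}(\mathrm{ALG}_2)\ge\Big(\frac{1}{2k}-o(1)\Big)\,\mathbb{E}(\mathrm{OPT}),$$ where $o(1)$ denotes a term tending to $0$ as $n\to\infty$.
   Context: $k$-armed bandit trading-prophet problem: there are $k$ item types and $n$ periods. For each type $i\in\{1,\dots,k\}$ and $j\in\{1,\dots,n\}$, $X^i_j\sim F^i_j$, all independent with absolutely continuous distributions, and $\sigma^1,\dots,\sigma^k$ are independent uniformly random permutations of $\{1,\dots,n\}$, independent of the prices. In period $t$ the agent observes the $k$ prices $X^1_{\sigma^1(t)},\dots,X^k_{\sigma^k(t)}$. The agent can hold at most one item in total (of any type) and starts in period 1 with no item. In a period, if she holds an item of type $j$ she may sell it at price $X^j_{\sigma^j(t)}$ (reward $+$price); if she holds no item she may buy an item of any type $j$ at price $X^j_{\sigma^j(t)}$ (reward $-$price); additionally, within the same period she may sell the item she holds and then buy a different one. Profit is total reward. $\mathrm{OPT}$ is the maximum total reward achievable with full knowledge of all realized prices. *)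

theory Defs
  imports "HOL-Probability.Probability" "HOL-Combinatorics.Permutations"
begin

text \<open>
  Types and periods are numbered from \<open>0\<close>. An agent is described by the position (\<open>None\<close>, or
  \<open>Some i\<close> for an item of type \<open>i\<close>) in which she leaves each period. As she may sell and then buy
  within one period, every sequence of positions is feasible, and moving from position \<open>a\<close> to
  position \<open>b\<close> earns the price of \<open>a\<close> minus the price of \<open>b\<close>; keeping the item nets to \<open>0\<close>.
\<close>

type_synonym position = "nat option"

definition positions :: "nat \<Rightarrow> position set" where
  "positions k = insert None (Some ` {..<k})"

definition position_price :: "(nat \<Rightarrow> real) \<Rightarrow> position \<Rightarrow> real" where
  "position_price q a = (case a of None \<Rightarrow> 0 | Some i \<Rightarrow> q i)"

definition previous :: "(nat \<Rightarrow> position) \<Rightarrow> nat \<Rightarrow> position" where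
  "previous h t = (case t of 0 \<Rightarrow> None | Suc s \<Rightarrow> h s)"

text \<open>Here \<open>p t i\<close> is the price of type \<open>i\<close> in period \<open>t\<close>. An item still held at the end is worth nothing.\<close>

definition profit :: "nat \<Rightarrow> (nat \<Rightarrow> nat \<Rightarrow> real) \<Rightarrow> (nat \<Rightarrow> position) \<Rightarrow> real" where
  "profit n p h =
     (\<Sum>t<n. position_price (p t) (previous h t) - position_price (p t) (h t))"

definition OPT :: "nat \<Rightarrow> nat \<Rightarrow> (nat \<Rightarrow> nat \<Rightarrow> real) \<Rightarrow> real" where
  "OPT k n p = Max (profit n p ` ({..<n} \<rightarrow>\<^sub>E positions k))"

text \<open>
  A (deterministic) online policy chooses its position in period \<open>t\<close> as a measurable function of
  the prices of all types in the periods up to and including \<open>t\<close>. The policy sees neither the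
  permutations nor future prices.
\<close>

type_synonym policy = "nat \<Rightarrow> (nat \<times> nat \<Rightarrow> real) \<Rightarrow> position"

definition online_policy :: "nat \<Rightarrow> nat \<Rightarrow> policy \<Rightarrow> bool" where
  "online_policy k n \<pi> \<longleftrightarrow>
     (\<forall>t<n. \<pi> t \<in> (\<Pi>\<^sub>M _\<in>{..t} \<times> {..<k}. borel) \<rightarrow>\<^sub>M count_space (positions k))"

definition policy_profit :: "nat \<Rightarrow> nat \<Rightarrow> policy \<Rightarrow> (nat \<Rightarrow> nat \<Rightarrow> real) \<Rightarrow> real" where
  "policy_profit k n \<pi> p =
     profit n p (\<lambda>t. \<pi> t (restrict (\<lambda>(s, i). p s i) ({..t} \<times> {..<k})))"

text \<open>\<open>F i j\<close> is the law of the \<open>j\<close>-th price of type \<open>i\<close>.\<close>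

definition bandit_instance :: "nat \<Rightarrow> nat \<Rightarrow> (nat \<Rightarrow> nat \<Rightarrow> real measure) \<Rightarrow> bool" where
  "bandit_instance k n F \<longleftrightarrow>
     (\<forall>i<k. \<forall>j<n. prob_space (F i j) \<and> sets (F i j) = sets borel \<and>
        absolutely_continuous lborel (F i j))"

definition bandit_space ::
    "nat \<Rightarrow> nat \<Rightarrow> (nat \<Rightarrow> nat \<Rightarrow> real measure) \<Rightarrow>
     ((nat \<times> nat \<Rightarrow> real) \<times> (nat \<Rightarrow> nat \<Rightarrow> nat)) measure" where
  "bandit_space k n F =
     (\<Pi>\<^sub>M (i, j)\<in>{..<k} \<times> {..<n}. F i j) \<Otimes>\<^sub>M
     (\<Pi>\<^sub>M _\<in>{..<k}. measure_pmf (pmf_of_set {\<sigma>. \<sigma> permutes {..<n}}))"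

definition price :: "(nat \<times> nat \<Rightarrow> real) \<times> (nat \<Rightarrow> nat \<Rightarrow> nat) \<Rightarrow> nat \<Rightarrow> nat \<Rightarrow> real" where
  "price \<omega> t i = (case \<omega> of (X, \<sigma>) \<Rightarrow> X (i, \<sigma> i t))"

text \<open>
  Prices need not have finite mean, so expectations are taken in the extended reals. They are
  meaningful only for quasi-integrable functions: on \<^typ>\<open>ereal\<close>, \<open>\<infinity> - \<infinity> = \<infinity>\<close>.
\<close>

definition quasi_integrable :: "'a measure \<Rightarrow> ('a \<Rightarrow> real) \<Rightarrow> bool" where
  "quasi_integrable M f \<longleftrightarrow> f \<in> borel_measurable M \<and>
     ((\<integral>\<^sup>+ x. ennreal (f x) \<partial>M) < \<infinity> \<or> (\<integral>\<^sup>+ x. ennreal (- f x) \<partial>M) < \<infinity>)"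

definition ext_expectation :: "'a measure \<Rightarrow> ('a \<Rightarrow> real) \<Rightarrow> ereal" where
  "ext_expectation M f =
     enn2ereal (\<integral>\<^sup>+ x. ennreal (f x) \<partial>M) - enn2ereal (\<integral>\<^sup>+ x. ennreal (- f x) \<partial>M)"

definition expected_OPT :: "nat \<Rightarrow> nat \<Rightarrow> (nat \<Rightarrow> nat \<Rightarrow> real measure) \<Rightarrow> ereal" where
  "expected_OPT k n F = ext_expectation (bandit_space k n F) (\<lambda>\<omega>. OPT k n (price \<omega>))"

definition expected_profit ::
    "nat \<Rightarrow> nat \<Rightarrow> (nat \<Rightarrow> nat \<Rightarrow> real measure) \<Rightarrow> policy \<Rightarrow> ereal" where
  "expected_profit k n F \<pi> =
     ext_expectation (bandit_space k n F) (\<lambda>\<omega>. policy_profit k n \<pi> (price \<omega>))"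

text \<open>
  An online algorithm knows the number of periods and the distributions, but not the realised
  prices, and selects a policy from this knowledge.
\<close>

type_synonym algorithm = "nat \<Rightarrow> (nat \<Rightarrow> nat \<Rightarrow> real measure) \<Rightarrow> policy"

definition online_algorithm :: "nat \<Rightarrow> algorithm \<Rightarrow> bool" where
  "online_algorithm k ALG \<longleftrightarrow>
     (\<forall>n F. bandit_instance k n F \<longrightarrow>
        online_policy k n (ALG n F) \<and>
        quasi_integrable (bandit_space k n F) (\<lambda>\<omega>. policy_profit k n (ALG n F) (price \<omega>)))"

end

theory Submission
  imports Defs "HOL-Real_Asymp.Real_Asymp"
begin

text \<open>
  Setting the price after the last period to \<open>0\<close>, the profit telescopes into the sum over periods of
  the price increments of the item held, so the optimum is at most the sum over types and periods of
  positive parts of increments. By \<open>(y - x)\<^sup>+ \<le> (y - c)\<^sup>+ + (c - x)\<^sup>+\<close>, the expected positive part for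
  one type is controlled by the mean distance of its prices to any level \<open>c\<close>. Trading the best single
  type, and holding it exactly when its price is at most the median \<open>c\<close> of the averaged price law,
  recovers half of that distance, up to the correlation caused by sampling without replacement,
  which costs a factor \<open>(n - 2) / (n - 1)\<close>. For \<open>n = 2\<close> that factor vanishes, and the median of one of
  the two laws is used instead.

  If a price has negative part of infinite mean, increments need not be quasi-integrable. Then
  buying at a negative price in the last period alone has infinite expected profit.
\<close>

section \<open>Thresholds for a single type\<close>

text \<open>\<open>ennreal\<close> sends negative reals to 0, so this is the mean of the positive
  part of x - m. It always exists, possibly as \<infinity>.\<close>

abbreviation upper_part :: "real measure \<Rightarrow> real \<Rightarrow> ennreal" where
  "upper_part \<mu> m \<equiv> \<integral>\<^sup>+ x. ennreal (x - m) \<partial>\<mu>"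

abbreviation lower_part :: "real measure \<Rightarrow> real \<Rightarrow> ennreal" where
  "lower_part \<mu> m \<equiv> \<integral>\<^sup>+ x. ennreal (m - x) \<partial>\<mu>"

text \<open>The balance of one law: x and y are its upper and lower part, c weighs the loss, a and b
  the gain, d the guaranteed surplus. Comparing coefficients avoids subtraction, so infinite parts
  are allowed.\<close>

lemma ennreal_combination_le:
  fixes x y :: ennreal
  assumes "0 \<le> a" "0 \<le> c" "0 \<le> d" "d \<le> a" "c + d \<le> b"
  shows "ennreal c * y + ennreal d * (x + y) \<le> ennreal a * x + ennreal b * y"
proof -
  have "ennreal c * y + ennreal d * (x + y) = ennreal d * x + ennreal (c + d) * y"
    using assms by (simp add: distrib_left distrib_right ac_simps)
  also have "\<dots> \<le> ennreal a * x + ennreal b * y"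
    using assms by (intro add_mono mult_right_mono ennreal_leI) auto
  finally show ?thesis .
qed

lemma sum_off_diagonal_swap:
  fixes f :: "nat \<Rightarrow> nat \<Rightarrow> 'a :: comm_monoid_add"
  shows "(\<Sum>j<n. \<Sum>l\<in>{..<n} - {j}. f j l) = (\<Sum>l<n. \<Sum>j\<in>{..<n} - {l}. f j l)"
proof -
  have "(\<Sum>j<n. \<Sum>l\<in>{..<n} - {j}. f j l) = (\<Sum>j\<in>{..<n}. \<Sum>l\<in>{l\<in>{..<n}. l \<noteq> j}. f j l)"
    by (intro sum.cong refl) auto
  also have "\<dots> = (\<Sum>l\<in>{..<n}. \<Sum>j\<in>{j\<in>{..<n}. l \<noteq> j}. f j l)"
    by (intro sum.swap_restrict) auto
  also have "\<dots> = (\<Sum>l<n. \<Sum>j\<in>{..<n} - {l}. f j l)"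
    by (intro sum.cong refl) auto
  finally show ?thesis .
qed

section \<open>Mean distance from a level\<close>

context real_distribution
begin

text \<open>A median minimises the mean distance. Pointwise, |x - m| plus |m - c| on the half-line
  of m away from c is at most |x - c| plus |m - c| on the other half-line. Both half-lines have mass
  1/2, so the finite extra terms cancel even if the mean distances are infinite.\<close>

lemma part_sum_median_le:
  assumes "cdf M m = 1 / 2"
  shows "upper_part M m + lower_part M m \<le> upper_part M c + lower_part M c"
proof -
  have parts: "upper_part M z + lower_part M z = (\<integral>\<^sup>+ x. ennreal \<bar>x - z\<bar> \<partial>M)" for z
    by (subst nn_integral_add[symmetric])
       (auto intro!: nn_integral_cong simp: abs_real_def ennreal_neg)
  have p: "prob {..m} = 1 / 2"
    using assms by (simp only: cdf_def)
  have "- {..m} = {m<..}" by auto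
  then have p': "prob {m<..} = 1 / 2"
    using prob_compl[of "{..m}"] p by (simp add: Compl_eq_Diff_UNIV[symmetric])
  have half: "emeasure M {..m} = ennreal (1 / 2)"
    unfolding emeasure_eq_measure p ..
  have half': "emeasure M {m<..} = ennreal (1 / 2)"
    unfolding emeasure_eq_measure p' ..
  have int: "(\<integral>\<^sup>+ x. ennreal \<bar>x - z\<bar> + ennreal \<bar>m - c\<bar> * indicator A x \<partial>M)
      = (\<integral>\<^sup>+ x. ennreal \<bar>x - z\<bar> \<partial>M) + ennreal \<bar>m - c\<bar> * ennreal (1 / 2)"
    if "A = {..m} \<or> A = {m<..}" for z A
    using that half half' by (subst nn_integral_add) (auto simp: nn_integral_cmult)
  let ?I = "\<lambda>z A. \<integral>\<^sup>+ x. ennreal \<bar>x - z\<bar> + ennreal \<bar>m - c\<bar> * indicator A x \<partial>M"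
  have "?I m (if c \<le> m then {m<..} else {..m}) \<le> ?I c (if c \<le> m then {..m} else {m<..})"
    by (intro nn_integral_mono) (auto simp: indicator_def simp flip: ennreal_plus)
  then have "(\<integral>\<^sup>+ x. ennreal \<bar>x - m\<bar> \<partial>M) + ennreal \<bar>m - c\<bar> * ennreal (1 / 2)
      \<le> (\<integral>\<^sup>+ x. ennreal \<bar>x - c\<bar> \<partial>M) + ennreal \<bar>m - c\<bar> * ennreal (1 / 2)"
    by (simp add: int split: if_splits)
  then show ?thesis
    unfolding parts by (subst (asm) (1 2) add.commute) (simp add: ennreal_mult_eq_top_iff ennreal_add_left_cancel_le)
qed

text \<open>Moving the level raises the lower part by at most the distance of the levels, so
  finiteness can be tested at one level.\<close>

lemma lower_part_finite:
  assumes "lower_part M a < \<infinity>"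
  shows "lower_part M b < \<infinity>"
proof -
  have "lower_part M b \<le> (\<integral>\<^sup>+ x. ennreal (a - x) + ennreal \<bar>b - a\<bar> \<partial>M)"
    by (intro nn_integral_mono)
       (smt (verit, best) ennreal_leI ennreal_neg ennreal_plus add_0)
  also have "\<dots> < \<infinity>"
    using assms by (subst nn_integral_add) (auto simp: emeasure_space_1[simplified])
  finally show ?thesis .
qed

end

section \<open>Choice of the threshold\<close>

lemma ex_sum_cdf_eq:
  fixes \<mu> :: "nat \<Rightarrow> real measure"
  assumes \<mu>: "\<And>j. j \<in> A \<Longrightarrow> real_distribution (\<mu> j)"
    and cont: "\<And>j x. j \<in> A \<Longrightarrow> isCont (cdf (\<mu> j)) x"
    and "0 < y" "y < real (card A)"
  shows "\<exists>m. (\<Sum>j\<in>A. cdf (\<mu> j) m) = y"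
proof -
  let ?Q = "\<lambda>m. \<Sum>j\<in>A. cdf (\<mu> j) m"
  have "(?Q \<longlongrightarrow> (\<Sum>j\<in>A. 0)) at_bot"
    by (intro tendsto_sum finite_borel_measure.cdf_lim_at_bot real_distribution.finite_borel_measure_M \<mu>)
  then have "eventually (\<lambda>m. ?Q m < y) at_bot"
    using \<open>0 < y\<close> by (auto dest: order_tendstoD(2))
  then obtain a where a: "?Q a < y"
    by (auto simp: eventually_at_bot_linorder)
  have "(?Q \<longlongrightarrow> (\<Sum>j\<in>A. 1)) at_top"
    by (intro tendsto_sum real_distribution.cdf_lim_at_top_prob \<mu>)
  then have "eventually (\<lambda>m. y < ?Q m) at_top"
    using \<open>y < real (card A)\<close> by (auto dest: order_tendstoD(1))
  then obtain b where b: "\<And>m. m \<ge> b \<Longrightarrow> y < ?Q m"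
    by (auto simp: eventually_at_top_linorder)
  have "\<exists>m\<ge>a. m \<le> max a b \<and> ?Q m = y"
    using a b[of "max a b"] cont by (intro IVT) (auto intro!: continuous_intros)
  then show ?thesis by auto
qed

text \<open>The share of the splitting bound that a threshold secures. For n \<ge> 3 it is the
  surplus weight n/2 - 1 obtained from the median of the averaged law, relative to the weight n - 1
  of the splitting bound. At n = 2 that quotient vanishes, and 1/4 comes from a separate
  argument.\<close>

definition trading_ratio :: "nat \<Rightarrow> real" where
  "trading_ratio n = (if n \<le> 2 then 1 / 4 else (real n - 2) / (2 * (real n - 1)))"

lemma trading_ratio_bounds: "1 / 4 \<le> trading_ratio n" "trading_ratio n \<le> 1"
  by (auto simp: trading_ratio_def field_simps)

lemma trading_ratio_tendsto: "trading_ratio \<longlonglongrightarrow> 1 / 2"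
proof -
  have "(\<lambda>n::nat. (real n - 2) / (2 * (real n - 1))) \<longlonglongrightarrow> 1 / 2"
    by real_asymp
  then show ?thesis
    by (rule Lim_transform_eventually)
       (auto simp: trading_ratio_def eventually_at_top_linorder intro!: exI[of _ 3])
qed

text \<open>A pair (j, l) stands for the indices of the prices in two successive periods. The right
  side is the gain and the first sum the loss of holding at prices up to m; the surplus is a fixed
  share of the splitting bound at level m'. For n = 2 the two levels may have to differ.\<close>

lemma ex_good_threshold:
  fixes \<mu> :: "nat \<Rightarrow> real measure"
  assumes \<mu>: "\<And>j. j < n \<Longrightarrow> real_distribution (\<mu> j)"
    and cont: "\<And>j x. j < n \<Longrightarrow> isCont (cdf (\<mu> j)) x"
  obtains m m' where
    "(\<Sum>j<n. \<Sum>l\<in>{..<n} - {j}. ennreal (cdf (\<mu> j) m) * lower_part (\<mu> l) m)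
      + ennreal (trading_ratio n) *
        (\<Sum>j<n. \<Sum>l\<in>{..<n} - {j}. upper_part (\<mu> l) m' + lower_part (\<mu> j) m')
      \<le> (\<Sum>j<n. \<Sum>l\<in>{..<n} - {j}.
          ennreal (cdf (\<mu> j) m) * upper_part (\<mu> l) m + lower_part (\<mu> j) m)"
proof -
  define q where "q m j = cdf (\<mu> j) m" for m j
  \<comment> \<open>\<open>Q m l\<close> is the weight of law l as the next price, collected over
    all other laws as the current one. Ordering the sums by l reduces the claim to a comparison for
    each law.\<close>
  define Q where "Q m l = (\<Sum>j\<in>{..<n} - {l}. q m j)" for m l
  define U where "U m l = upper_part (\<mu> l) m" for m l
  define V where "V m l = lower_part (\<mu> l) m" for m l
  have q01: "0 \<le> q m j" "q m j \<le> 1" if "j < n" for m j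
    using finite_borel_measure.cdf_nonneg[OF real_distribution.finite_borel_measure_M[OF \<mu>[OF that]]]
      real_distribution.cdf_bounded_prob[OF \<mu>[OF that]] by (auto simp: q_def)
  have Q0: "0 \<le> Q m l" for m l
    unfolding Q_def by (intro sum_nonneg) (auto simp: q01)
  have weights: "(\<Sum>j<n. \<Sum>l\<in>{..<n} - {j}. ennreal (q m j) * f l) = (\<Sum>l<n. ennreal (Q m l) * f l)"
    for m and f :: "nat \<Rightarrow> ennreal"
  proof -
    have "ennreal (Q m l) = (\<Sum>j\<in>{..<n} - {l}. ennreal (q m j))" for l
      unfolding Q_def by (subst sum_ennreal) (auto simp: q01)
    then show ?thesis
      by (subst sum_off_diagonal_swap) (simp only: sum_distrib_right)
  qed
  have const: "(\<Sum>j<n. \<Sum>l\<in>{..<n} - {j}. f j) = ennreal (real n - 1) * (\<Sum>j<n. f j)"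
    for f :: "nat \<Rightarrow> ennreal"
    by (auto simp: sum_distrib_left ennreal_of_nat_eq_real_of_nat of_nat_diff intro!: sum.cong)
  have spread: "(\<Sum>j<n. \<Sum>l\<in>{..<n} - {j}. U m l + V m j) = ennreal (real n - 1) * (\<Sum>j<n. U m j + V m j)"
    for m
  proof -
    have "(\<Sum>j<n. \<Sum>l\<in>{..<n} - {j}. U m l) = (\<Sum>j<n. \<Sum>l\<in>{..<n} - {j}. U m j)"
      by (rule sum_off_diagonal_swap)
    then show ?thesis
      by (simp only: sum.distrib const distrib_left)
  qed
  have gain: "(\<Sum>j<n. \<Sum>l\<in>{..<n} - {j}. ennreal (q m j) * U m l + V m j)
      = (\<Sum>l<n. ennreal (Q m l) * U m l + ennreal (real n - 1) * V m l)" for m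
    by (simp only: sum.distrib const weights sum_distrib_left)
  have "\<exists>m m'. (\<Sum>l<n. ennreal (Q m l) * V m l)
      + ennreal (trading_ratio n) * (ennreal (real n - 1) * (\<Sum>j<n. U m' j + V m' j))
      \<le> (\<Sum>l<n. ennreal (Q m l) * U m l + ennreal (real n - 1) * V m l)"
  proof -
    consider "n \<le> 1" | "n = 2" | "n \<ge> 3" by linarith
    then show ?thesis
    proof cases
      case 1
      then have "n = 0 \<or> n = 1" by auto
      then show ?thesis by (auto simp: Q_def lessThan_Suc)
    next
      case 2
      have *: "\<exists>m. q m j = 1 / 2" if "j < n" for j
        using ex_sum_cdf_eq[of "{j}" \<mu> "1/2"] \<mu> cont that by (auto simp: q_def)
      obtain m0 where m0: "q m0 0 = 1 / 2" using * 2 by force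
      obtain m1 where m1: "q m1 1 = 1 / 2" using * 2 by force
      \<comment> \<open>With two laws the weight of each is the cdf of the other, so a median of one
        law gives weight 1/2 to the other.\<close>
      have Q: "Q m 0 = q m 1" "Q m 1 = q m 0" for m
      proof -
        have "{..<n} - {0} = {1}" "{..<n} - {1} = {0}" using 2 by auto
        then show "Q m 0 = q m 1" "Q m 1 = q m 0" by (simp_all add: Q_def)
      qed
      have half: "ennreal (1 / 4) * (x + y) \<le> ennreal (1 / 2) * y" if "x \<le> y" for x y :: ennreal
      proof -
        have "ennreal (1 / 4) * (x + y) \<le> ennreal (1 / 4) * (y + y)"
          using that by (intro mult_left_mono add_mono) auto
        also have "\<dots> = (ennreal (1 / 4) + ennreal (1 / 4)) * y"
          by (simp only: distrib_left distrib_right)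
        finally show ?thesis by (simp flip: ennreal_plus)
      qed
      \<comment> \<open>A law of weight 1/2 secures half of its own mean distance; by
        \<open>second\<close> the other law does no harm.\<close>
      have first: "ennreal (Q m l) * V m l + ennreal (1 / 2) * (U m l + V m l)
        \<le> ennreal (Q m l) * U m l + ennreal 1 * V m l" if "Q m l = 1 / 2" for m l
        using that by (intro ennreal_combination_le) auto
      have second: "ennreal (Q m l) * V m l \<le> ennreal (Q m l) * U m l + ennreal 1 * V m l"
        if "l < n" for m l
      proof -
        have "Q m l \<le> 1"
          using that 2 Q[of m] q01[of _ m] by (auto simp: less_2_cases_iff)
        then have "ennreal (Q m l) * V m l \<le> ennreal 1 * V m l"
          by (intro mult_right_mono ennreal_leI) auto
        then show ?thesis
          by (rule add_increasing[OF zero_le])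
      qed
      have combine: "(\<Sum>l<n. ennreal (Q m l) * V m l)
          + ennreal (trading_ratio n) * (ennreal (real n - 1) * (\<Sum>j<n. U m' j + V m' j))
          \<le> (\<Sum>l<n. ennreal (Q m l) * U m l + ennreal (real n - 1) * V m l)"
        if l: "l = 0 \<or> l = 1" and Ql: "Q m l = 1 / 2"
          and le: "ennreal (1 / 4) * (U m' 0 + V m' 0 + (U m' 1 + V m' 1)) \<le> ennreal (1 / 2) * (U m l + V m l)"
        for m m' l
      proof -
        let ?A = "\<lambda>l. ennreal (Q m l) * V m l"
        let ?B = "\<lambda>l. ennreal (Q m l) * U m l + ennreal 1 * V m l"
        have sum2: "(\<Sum>l<n. f l) = f l + f (1 - l)" for f :: "nat \<Rightarrow> ennreal"
          using l 2 by (auto simp: numeral_2_eq_2 add.commute)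
        have D: "(\<Sum>j<n. U m' j + V m' j) = U m' 0 + V m' 0 + (U m' 1 + V m' 1)"
          using 2 by (simp add: numeral_2_eq_2)
        have n1: "real n - 1 = 1" and ratio: "trading_ratio n = 1 / 4"
          using 2 by (simp_all add: trading_ratio_def)
        have "(?A l + ?A (1 - l)) + ennreal (1 / 4) * (U m' 0 + V m' 0 + (U m' 1 + V m' 1))
            \<le> (?A l + ?A (1 - l)) + ennreal (1 / 2) * (U m l + V m l)"
          using le by (rule add_left_mono)
        also have "\<dots> = (?A l + ennreal (1 / 2) * (U m l + V m l)) + ?A (1 - l)"
          by (simp only: ac_simps)
        also have "\<dots> \<le> ?B l + ?B (1 - l)"
          by (rule add_mono[OF first[OF Ql] second]) (use 2 in simp)
        finally show ?thesis
          unfolding D n1 ratio sum2 by simp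
      qed
      show ?thesis
      \<comment> \<open>The law with the larger distance should get weight 1/2. If that is law 0,
        the median \<open>m1\<close> of law 1 serves as both levels.\<close>
      proof (cases "U m1 1 + V m1 1 \<le> U m1 0 + V m1 0")
        case True
        have "ennreal (1 / 4) * (U m1 0 + V m1 0 + (U m1 1 + V m1 1)) \<le> ennreal (1 / 2) * (U m1 0 + V m1 0)"
          using half[OF True] by (simp only: add.commute)
        then show ?thesis
          using combine[of 0 m1 m1] m1 Q(1) by (intro exI) auto
      next
        case False
        \<comment> \<open>Here law 1 needs weight 1/2, so the threshold becomes \<open>m0\<close>
          while the splitting level stays \<open>m1\<close>. As \<open>m1\<close> is a median of law
          1, passing to \<open>m0\<close> cannot lower the distance of law 1, which therefore still
          dominates.\<close>
        have "U m1 1 + V m1 1 \<le> U m0 1 + V m0 1"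
          using real_distribution.part_sum_median_le[OF \<mu>, of 1 m1 m0] 2 m1
          by (simp add: U_def V_def q_def)
        moreover from this have "U m1 0 + V m1 0 \<le> U m0 1 + V m0 1"
          using False by simp
        then have "ennreal (1 / 4) * (U m1 0 + V m1 0 + (U m0 1 + V m0 1)) \<le> ennreal (1 / 2) * (U m0 1 + V m0 1)"
          by (rule half)
        ultimately have "ennreal (1 / 4) * (U m1 0 + V m1 0 + (U m1 1 + V m1 1))
            \<le> ennreal (1 / 2) * (U m0 1 + V m0 1)"
          by (meson add_left_mono mult_left_mono order_trans zero_le)
        then show ?thesis
          using combine[of 1 m0 m1] m0 Q(2) by (intro exI) auto
      qed
    next
      case 3
      \<comment> \<open>A median of the average of the n laws. Leaving out law l lowers the sum n/2
        by at most 1, so every weight lies between n/2 - 1 and n/2.\<close>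
      then obtain m where m: "(\<Sum>j<n. q m j) = real n / 2"
        using ex_sum_cdf_eq[of "{..<n}" \<mu> "real n / 2"] \<mu> cont by (auto simp: q_def)
      have Q: "Q m l = real n / 2 - q m l" if "l < n" for l
        using m that unfolding Q_def by (subst sum_diff1) auto
      have ratio: "ennreal (trading_ratio n) * (ennreal (real n - 1) * x) = ennreal (real n / 2 - 1) * x" for x
      proof -
        have "ennreal (trading_ratio n) * ennreal (real n - 1) = ennreal (real n / 2 - 1)"
        proof (subst ennreal_mult[symmetric])
          have "trading_ratio n * (real n - 1) = real n / 2 - 1"
            using 3 by (simp add: trading_ratio_def field_simps)
          then show "ennreal (trading_ratio n * (real n - 1)) = ennreal (real n / 2 - 1)"
            by simp
        qed (use 3 trading_ratio_bounds[of n] in auto)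
        then show ?thesis by (simp flip: mult.assoc)
      qed
      have "(\<Sum>l<n. ennreal (Q m l) * V m l) + ennreal (real n / 2 - 1) * (\<Sum>j<n. U m j + V m j)
          = (\<Sum>l<n. ennreal (Q m l) * V m l + ennreal (real n / 2 - 1) * (U m l + V m l))"
        by (simp only: sum.distrib sum_distrib_left[symmetric])
      also have "\<dots> \<le> (\<Sum>l<n. ennreal (Q m l) * U m l + ennreal (real n - 1) * V m l)"
      proof (intro sum_mono)
        fix l assume "l \<in> {..<n}"
        then have "0 \<le> q m l" "q m l \<le> 1" "Q m l = real n / 2 - q m l"
          using q01 Q by auto
        \<comment> \<open>The surplus n/2 - 1 fits both coefficients: it is at most
          \<open>Q m l\<close>, and together with \<open>Q m l\<close> it is at most n - 1.\<close>
        then show "ennreal (Q m l) * V m l + ennreal (real n / 2 - 1) * (U m l + V m l)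
            \<le> ennreal (Q m l) * U m l + ennreal (real n - 1) * V m l"
          using 3 Q0[of m l] by (intro ennreal_combination_le) auto
      qed
      finally show ?thesis
        unfolding ratio by blast
    qed
  qed
  then obtain m m' where "(\<Sum>l<n. ennreal (Q m l) * V m l)
      + ennreal (trading_ratio n) * (ennreal (real n - 1) * (\<Sum>j<n. U m' j + V m' j))
      \<le> (\<Sum>l<n. ennreal (Q m l) * U m l + ennreal (real n - 1) * V m l)"
    by blast
  then show thesis
    unfolding gain[symmetric] weights[symmetric] spread[symmetric]
    unfolding U_def V_def q_def by (rule that)
qed

section \<open>Prices in random order\<close>

lemma (in product_prob_space) nn_integral_PiM_mult:
  assumes I: "finite I" "a \<in> I" "b \<in> I" "a \<noteq> b"
    and u: "u \<in> borel_measurable (M a)" and v: "v \<in> borel_measurable (M b)"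
  shows "(\<integral>\<^sup>+ x. u (x a) * v (x b) \<partial>PiM I M) = (\<integral>\<^sup>+ x. u x \<partial>M a) * (\<integral>\<^sup>+ x. v x \<partial>M b)"
proof -
  \<comment> \<open>All other coordinates carry the constant 1, so the integrand becomes a product
    over the whole index set.\<close>
  define f where "f = (\<lambda>i x. if i = a then u x else if i = b then v x else (1 :: ennreal))"
  have two: "(\<Prod>i\<in>I. g i) = g a * g b" if "\<And>i. i \<in> I - {a, b} \<Longrightarrow> g i = 1" for g :: "'i \<Rightarrow> ennreal"
    using I that by (subst prod.mono_neutral_right[of I "{a, b}"]) auto
  have "(\<integral>\<^sup>+ x. u (x a) * v (x b) \<partial>PiM I M) = (\<integral>\<^sup>+ x. (\<Prod>i\<in>I. f i (x i)) \<partial>PiM I M)"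
    using I by (subst two) (auto simp: f_def)
  also have "\<dots> = (\<Prod>i\<in>I. integral\<^sup>N (M i) (f i))"
  proof (rule product_nn_integral_prod[OF \<open>finite I\<close>])
    show "f i \<in> borel_measurable (M i)" for i
      using u v by (cases "i = a"; cases "i = b") (auto simp: f_def)
  qed
  also have "\<dots> = integral\<^sup>N (M a) (f a) * integral\<^sup>N (M b) (f b)"
    by (rule two) (auto simp: f_def M.emeasure_space_1)
  finally show ?thesis
    using I by (simp add: f_def)
qed

lemma (in product_prob_space) nn_integral_PiM_component:
  assumes "a \<in> I" "u \<in> borel_measurable (M a)"
  shows "(\<integral>\<^sup>+ x. u (x a) \<partial>PiM I M) = (\<integral>\<^sup>+ x. u x \<partial>M a)"
  using assms by (subst PiM_component[of a, symmetric]) (auto simp: nn_integral_distr)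

section \<open>Averages over permutations\<close>

lemma sum_permutations_comp:
  assumes "\<tau> permutes S"
  shows "(\<Sum>\<sigma> | \<sigma> permutes S. f (\<sigma> \<circ> \<tau>)) = (\<Sum>\<sigma> | \<sigma> permutes S. f \<sigma>)"
  using assms
  by (intro sum.reindex_bij_witness[where i = "\<lambda>\<sigma>. \<sigma> \<circ> inv \<tau>" and j = "\<lambda>\<sigma>. \<sigma> \<circ> \<tau>"])
     (auto simp: permutes_compose permutes_inv comp_assoc permutes_inv_o)

text \<open>Two-transitivity of the symmetric group: send a to c, then swap the image of b with d.
  The second swap fixes c, which is neither d nor the image of b.\<close>

lemma ex_permutes_pair:
  assumes "a \<in> S" "b \<in> S" "a \<noteq> b" "c \<in> S" "d \<in> S" "c \<noteq> d"
  obtains \<tau> where "\<tau> permutes S" "\<tau> a = c" "\<tau> b = d"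
proof
  let ?\<rho> = "Transposition.transpose a c"
  show "Transposition.transpose (?\<rho> b) d \<circ> ?\<rho> permutes S"
    using assms by (intro permutes_compose permutes_swap_id) (auto simp: Transposition.transpose_def)
  show "(Transposition.transpose (?\<rho> b) d \<circ> ?\<rho>) a = c" "(Transposition.transpose (?\<rho> b) d \<circ> ?\<rho>) b = d"
    using assms by (auto simp: Transposition.transpose_def)
qed

text \<open>The images of two distinct periods are uniform over ordered pairs of distinct indices;
  the form without division suits every commutative semiring. Right translation replaces (t, s) by
  any pair (j, l), and after summing over all pairs each permutation merely rearranges them.\<close>

lemma sum_permutations_pair:
  fixes f :: "nat \<Rightarrow> nat \<Rightarrow> 'a :: comm_semiring_1"
  assumes "t < n" "s < n" "t \<noteq> s"
  shows "of_nat (n * (n - 1)) * (\<Sum>\<sigma> | \<sigma> permutes {..<n}. f (\<sigma> t) (\<sigma> s))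
    = of_nat (fact n) * (\<Sum>j<n. \<Sum>l\<in>{..<n} - {j}. f j l)"
proof -
  let ?P = "{\<sigma>. \<sigma> permutes {..<n}}"
  let ?D = "Sigma {..<n} (\<lambda>j. {..<n} - {j})"
  have eq: "(\<Sum>\<sigma>\<in>?P. f (\<sigma> t) (\<sigma> s)) = (\<Sum>\<sigma>\<in>?P. f (\<sigma> j) (\<sigma> l))" if jl: "(j, l) \<in> ?D" for j l
  proof -
    obtain \<tau> where \<tau>: "\<tau> permutes {..<n}" "\<tau> t = j" "\<tau> s = l"
      using assms jl by (elim SigmaE) (rule ex_permutes_pair[of t "{..<n}" s j l], auto)
    have "(\<Sum>\<sigma>\<in>?P. f (\<sigma> j) (\<sigma> l)) = (\<Sum>\<sigma>\<in>?P. f ((\<sigma> \<circ> \<tau>) t) ((\<sigma> \<circ> \<tau>) s))"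
      using \<tau> by simp
    also have "\<dots> = (\<Sum>\<sigma>\<in>?P. f (\<sigma> t) (\<sigma> s))"
      by (rule sum_permutations_comp[OF \<tau>(1)])
    finally show ?thesis ..
  qed
  have pairs: "(\<Sum>(j, l)\<in>?D. f (\<sigma> j) (\<sigma> l)) = (\<Sum>(j, l)\<in>?D. f j l)" if "\<sigma> \<in> ?P" for \<sigma>
  proof -
    have \<sigma>: "\<sigma> permutes {..<n}" using that by simp
    show ?thesis
      using permutes_in_image[OF \<sigma>] permutes_in_image[OF permutes_inv[OF \<sigma>]]
        permutes_inverses[OF \<sigma>] permutes_inj[OF \<sigma>]
      by (intro sum.reindex_bij_witness[where i = "map_prod (inv \<sigma>) (inv \<sigma>)" and j = "map_prod \<sigma> \<sigma>"])
         (auto simp: inj_eq, metis+)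
  qed
  have "card ?D = n * (n - 1)" by (subst card_SigmaI) auto
  then have "of_nat (n * (n - 1)) * (\<Sum>\<sigma>\<in>?P. f (\<sigma> t) (\<sigma> s))
      = (\<Sum>(j, l)\<in>?D. \<Sum>\<sigma>\<in>?P. f (\<sigma> t) (\<sigma> s))"
    by simp
  also have "\<dots> = (\<Sum>(j, l)\<in>?D. \<Sum>\<sigma>\<in>?P. f (\<sigma> j) (\<sigma> l))"
    using eq by (intro sum.cong) auto
  also have "\<dots> = (\<Sum>\<sigma>\<in>?P. \<Sum>(j, l)\<in>?D. f (\<sigma> j) (\<sigma> l))"
    by (subst sum.swap) (simp add: case_prod_beta)
  also have "\<dots> = (\<Sum>\<sigma>\<in>?P. \<Sum>(j, l)\<in>?D. f j l)"
    by (intro sum.cong refl pairs)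
  also have "\<dots> = of_nat (fact n) * (\<Sum>j<n. \<Sum>l\<in>{..<n} - {j}. f j l)"
    by (simp add: card_permutations sum.Sigma)
  finally show ?thesis .
qed

section \<open>The probability space of an instance\<close>

locale bandit =
  fixes k n :: nat and F :: "nat \<Rightarrow> nat \<Rightarrow> real measure"
  assumes inst: "bandit_instance k n F"
begin

abbreviation prices :: "(nat \<times> nat \<Rightarrow> real) measure" where
  "prices \<equiv> \<Pi>\<^sub>M (i, j)\<in>{..<k} \<times> {..<n}. F i j"

abbreviation orders :: "(nat \<Rightarrow> nat \<Rightarrow> nat) measure" where
  "orders \<equiv> \<Pi>\<^sub>M _\<in>{..<k}. measure_pmf (pmf_of_set {\<sigma>. \<sigma> permutes {..<n}})"

lemma real_distribution_F: "real_distribution (F i j)" if "i < k" "j < n"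
  using inst that by (intro real_distribution.intro real_distribution_axioms.intro)
    (auto simp: bandit_instance_def)

text \<open>Absolute continuity rules out atoms; this is what makes exact medians available.\<close>

lemma isCont_cdf_F: "isCont (cdf (F i j)) x" if "i < k" "j < n"
proof -
  interpret real_distribution "F i j" using that by (rule real_distribution_F)
  have "{x} \<in> null_sets lborel" by (simp add: null_sets_def)
  then have "{x} \<in> null_sets (F i j)"
    using inst that by (auto simp: bandit_instance_def absolutely_continuous_def)
  then show ?thesis
    by (simp add: isCont_cdf measure_def null_sets_def)
qed

text \<open>The product locales demand a probability measure at every index, so \<open>F\<close> is padded.\<close>

lemma ex_padded:
  "\<exists>F'. product_prob_space F' \<and> prices = PiM ({..<k} \<times> {..<n}) F' \<and>
    (\<forall>i<k. \<forall>j<n. F' (i, j) = F i j)"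
proof (intro exI conjI)
  let ?F' = "\<lambda>(i, j). if i < k \<and> j < n then F i j else return borel 0"
  have *: "prob_space (?F' p)" for p
    using inst by (auto simp: bandit_instance_def prob_space_return split: prod.split)
  then show "product_prob_space ?F'"
    by (intro product_prob_spaceI)
  show "prices = PiM ({..<k} \<times> {..<n}) ?F'"
    by (intro PiM_cong) auto
qed auto

lemma prob_space_prices: "prob_space prices"
  using inst by (intro prob_space_PiM) (auto simp: bandit_instance_def)

lemma prob_space_orders: "prob_space orders"
  by (intro prob_space_PiM prob_space_measure_pmf)

lemma nn_integral_price_pair:
  assumes "i < k" "a < n" "b < n" "a \<noteq> b" "u \<in> borel_measurable borel" "v \<in> borel_measurable borel"
  shows "(\<integral>\<^sup>+ X. u (X (i, a)) * v (X (i, b)) \<partial>prices) = (\<integral>\<^sup>+ x. u x \<partial>F i a) * (\<integral>\<^sup>+ x. v x \<partial>F i b)"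
proof -
  obtain F' where F': "product_prob_space F'" "prices = PiM ({..<k} \<times> {..<n}) F'"
    "\<And>i j. i < k \<Longrightarrow> j < n \<Longrightarrow> F' (i, j) = F i j" using ex_padded by blast
  interpret real_distribution "F i a" using assms by (intro real_distribution_F)
  interpret B: real_distribution "F i b" using assms by (intro real_distribution_F)
  show ?thesis
    using assms F'(3) unfolding F'(2)
    by (subst product_prob_space.nn_integral_PiM_mult[OF F'(1)]) auto
qed

lemma nn_integral_price_single:
  assumes "i < k" "a < n" "u \<in> borel_measurable borel"
  shows "(\<integral>\<^sup>+ X. u (X (i, a)) \<partial>prices) = (\<integral>\<^sup>+ x. u x \<partial>F i a)"
proof -
  obtain F' where F': "product_prob_space F'" "prices = PiM ({..<k} \<times> {..<n}) F'"
    "\<And>i j. i < k \<Longrightarrow> j < n \<Longrightarrow> F' (i, j) = F i j" using ex_padded by blast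
  interpret real_distribution "F i a" using assms by (intro real_distribution_F)
  show ?thesis
    using assms F'(3) unfolding F'(2)
    by (subst product_prob_space.nn_integral_PiM_component[OF F'(1)]) auto
qed

text \<open>By Tonelli the prices are integrated first. What remains depends on the order of type i
  alone, whose marginal is uniform on the n! permutations.\<close>

lemma nn_integral_bandit_space:
  fixes f :: "(nat \<times> nat \<Rightarrow> real) \<Rightarrow> (nat \<Rightarrow> nat) \<Rightarrow> ennreal"
  assumes "i < k" and f: "(\<lambda>(X, \<sigma>). f X (\<sigma> i)) \<in> borel_measurable (bandit_space k n F)"
  shows "(\<integral>\<^sup>+ (X, \<sigma>). f X (\<sigma> i) \<partial>bandit_space k n F)
    = (\<Sum>\<sigma> | \<sigma> permutes {..<n}. \<integral>\<^sup>+ X. f X \<sigma> \<partial>prices) / of_nat (fact n)"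
proof -
  interpret P: prob_space prices by (rule prob_space_prices)
  interpret R: prob_space orders by (rule prob_space_orders)
  interpret pair_sigma_finite prices orders ..
  let ?p = "pmf_of_set {\<sigma>. \<sigma> permutes {..<n}}"
  let ?h = "\<lambda>\<sigma>. \<integral>\<^sup>+ X. f X \<sigma> \<partial>prices"
  have "(\<integral>\<^sup>+ (X, \<sigma>). f X (\<sigma> i) \<partial>bandit_space k n F) = (\<integral>\<^sup>+ \<sigma>. ?h (\<sigma> i) \<partial>orders)"
    using f unfolding bandit_space_def by (subst nn_integral_snd[symmetric]) auto
  also have "\<dots> = (\<integral>\<^sup>+ \<sigma>. ?h \<sigma> \<partial>distr orders (measure_pmf ?p) (\<lambda>\<sigma>. \<sigma> i))"
    using \<open>i < k\<close> by (intro nn_integral_distr[symmetric] measurable_component_singleton) auto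
  also have "distr orders (measure_pmf ?p) (\<lambda>\<sigma>. \<sigma> i) = measure_pmf ?p"
    using \<open>i < k\<close> by (intro distr_PiM_component[where M = "\<lambda>_. measure_pmf ?p"] prob_space_measure_pmf) auto
  also have "(\<integral>\<^sup>+ \<sigma>. ?h \<sigma> \<partial>measure_pmf ?p) = (\<Sum>\<sigma> | \<sigma> permutes {..<n}. ?h \<sigma>) / of_nat (fact n)"
    by (subst nn_integral_pmf_of_set)
       (auto simp: card_permutations finite_permutations intro!: exI[of _ id] permutes_id)
  finally show ?thesis .
qed

lemma measurable_price [measurable]:
  assumes "i < k"
  shows "(\<lambda>\<omega>. price \<omega> t i) \<in> borel_measurable (bandit_space k n F)"
proof -
  \<comment> \<open>All j are needed: points of \<open>orders\<close> are not confined to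
    permutations, so the index read in period t may be any number. It takes countably many values,
    which allows a countable composition at the end.\<close>
  have coord: "(\<lambda>X. X (i, j)) \<in> borel_measurable prices" for j
  proof (cases "j < n")
    case True
    then have "(\<lambda>X. X (i, j)) \<in> prices \<rightarrow>\<^sub>M F i j"
      using assms measurable_component_singleton[of "(i, j)" "{..<k} \<times> {..<n}" "\<lambda>(i, j). F i j"] by auto
    also have "prices \<rightarrow>\<^sub>M F i j = borel_measurable prices"
      using inst assms True by (intro measurable_cong_sets) (auto simp: bandit_instance_def)
    finally show ?thesis .
  next
    case False
    \<comment> \<open>Points of the product space are extensional, hence constantly
      \<open>undefined\<close> outside the index set.\<close>
    have "(\<lambda>X. X (i, j)) \<in> borel_measurable prices \<longleftrightarrow> (\<lambda>X. undefined :: real) \<in> borel_measurable prices"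
      by (intro measurable_cong) (use False in \<open>auto simp: space_PiM PiE_def extensional_def\<close>)
    then show ?thesis by simp
  qed
  let ?p = "measure_pmf (pmf_of_set {\<sigma>. \<sigma> permutes {..<n}})"
  have "(\<lambda>\<sigma>. \<sigma> i) \<in> orders \<rightarrow>\<^sub>M ?p"
    using assms by (intro measurable_component_singleton) auto
  then have "(\<lambda>\<sigma>. \<sigma> i t) \<in> orders \<rightarrow>\<^sub>M count_space UNIV"
    by (rule measurable_compose) simp
  then have "(\<lambda>\<omega>. snd \<omega> i t) \<in> prices \<Otimes>\<^sub>M orders \<rightarrow>\<^sub>M count_space UNIV"
    by (rule measurable_compose[OF measurable_snd])
  moreover have "(\<lambda>\<omega>. fst \<omega> (i, j)) \<in> borel_measurable (prices \<Otimes>\<^sub>M orders)" for j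
    by (rule measurable_compose[OF measurable_fst coord])
  ultimately have "(\<lambda>\<omega>. fst \<omega> (i, snd \<omega> i t)) \<in> borel_measurable (prices \<Otimes>\<^sub>M orders)"
    by (rule measurable_compose_countable[rotated])
  then show ?thesis
    by (simp add: bandit_space_def price_def case_prod_beta')
qed

text \<open>In two distinct periods one type shows a uniformly random ordered pair of distinct laws,
  and given the pair the two prices are independent. The integral factorises for each fixed \<sigma>
  and is then averaged over \<sigma>.\<close>

lemma nn_integral_price_steps:
  assumes "i < k" "t < n" "s < n" "t \<noteq> s"
    and [measurable]: "u \<in> borel_measurable borel" "v \<in> borel_measurable borel"
  shows "(\<integral>\<^sup>+ \<omega>. u (price \<omega> t i) * v (price \<omega> s i) \<partial>bandit_space k n F)
    = (\<Sum>j<n. \<Sum>l\<in>{..<n} - {j}. (\<integral>\<^sup>+ x. u x \<partial>F i j) * (\<integral>\<^sup>+ x. v x \<partial>F i l))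
      / of_nat (n * (n - 1))"
proof -
  define S where "S = (\<Sum>\<sigma> | \<sigma> permutes {..<n}.
    (\<integral>\<^sup>+ x. u x \<partial>F i (\<sigma> t)) * (\<integral>\<^sup>+ x. v x \<partial>F i (\<sigma> s)))"
  have "(\<integral>\<^sup>+ \<omega>. u (price \<omega> t i) * v (price \<omega> s i) \<partial>bandit_space k n F)
      = (\<integral>\<^sup>+ (X, \<sigma>). u (X (i, \<sigma> i t)) * v (X (i, \<sigma> i s)) \<partial>bandit_space k n F)"
    by (intro nn_integral_cong) (auto simp: price_def)
  also have "\<dots> = (\<Sum>\<sigma> | \<sigma> permutes {..<n}. \<integral>\<^sup>+ X. u (X (i, \<sigma> t)) * v (X (i, \<sigma> s)) \<partial>prices) / of_nat (fact n)"
  proof (rule nn_integral_bandit_space[OF \<open>i < k\<close>])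
    have "(\<lambda>\<omega>. u (price \<omega> t i) * v (price \<omega> s i)) \<in> borel_measurable (bandit_space k n F)"
      using \<open>i < k\<close> by measurable
    then show "(\<lambda>(X, \<sigma>). u (X (i, \<sigma> i t)) * v (X (i, \<sigma> i s))) \<in> borel_measurable (bandit_space k n F)"
      by (simp add: price_def case_prod_beta')
  qed
  also have "(\<Sum>\<sigma> | \<sigma> permutes {..<n}. \<integral>\<^sup>+ X. u (X (i, \<sigma> t)) * v (X (i, \<sigma> s)) \<partial>prices) = S"
    unfolding S_def
  proof (intro sum.cong refl)
    fix \<sigma> assume "\<sigma> \<in> {\<sigma>. \<sigma> permutes {..<n}}"
    then have "\<sigma> t < n" "\<sigma> s < n" "\<sigma> t \<noteq> \<sigma> s"
      using assms permutes_in_image[of \<sigma> "{..<n}"] by (auto dest!: permutes_inj injD)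
    then show "(\<integral>\<^sup>+ X. u (X (i, \<sigma> t)) * v (X (i, \<sigma> s)) \<partial>prices)
        = (\<integral>\<^sup>+ x. u x \<partial>F i (\<sigma> t)) * (\<integral>\<^sup>+ x. v x \<partial>F i (\<sigma> s))"
      using assms by (intro nn_integral_price_pair)
  qed
  also have "S / of_nat (fact n) = (\<Sum>j<n. \<Sum>l\<in>{..<n} - {j}. (\<integral>\<^sup>+ x. u x \<partial>F i j) * (\<integral>\<^sup>+ x. v x \<partial>F i l))
      / of_nat (n * (n - 1))" (is "_ = ?T / _")
  proof -
    \<comment> \<open>The division-free identity is turned into quotients; in \<open>ennreal\<close>
      this needs both counts to be neither 0 nor \<infinity>.\<close>
    have eq: "of_nat (n * (n - 1)) * S = of_nat (fact n) * ?T"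
      unfolding S_def using assms by (intro sum_permutations_pair)
    have pos: "of_nat (n * (n - 1)) \<noteq> (0 :: ennreal)" "of_nat (fact n) \<noteq> (0 :: ennreal)"
      "of_nat (n * (n - 1)) \<noteq> (\<top> :: ennreal)" "of_nat (fact n) \<noteq> (\<top> :: ennreal)"
      using assms by (auto simp: ennreal_mult_eq_top_iff)
    have "S = (of_nat (n * (n - 1)) * S) / of_nat (n * (n - 1))"
      using pos by (simp add: ennreal_mult_divide_eq mult.commute)
    also have "\<dots> = of_nat (fact n) * (?T / of_nat (n * (n - 1)))"
      by (simp only: eq ennreal_times_divide)
    finally have "S / of_nat (fact n) = ?T / of_nat (n * (n - 1)) * of_nat (fact n) / of_nat (fact n)"
      by (simp only: mult.commute)
    then show ?thesis
      by (simp only: ennreal_mult_divide_eq[OF pos(2,4)])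
  qed
  finally show ?thesis .
qed

text \<open>The transposition of t and j is one of the finitely many permutations averaged over, and
  its term is already infinite.\<close>

lemma nn_integral_price_eq_top:
  assumes "i < k" "t < n" "j < n" and [measurable]: "u \<in> borel_measurable borel"
    and "(\<integral>\<^sup>+ x. u x \<partial>F i j) = \<top>"
  shows "(\<integral>\<^sup>+ \<omega>. u (price \<omega> t i) \<partial>bandit_space k n F) = \<top>"
proof -
  have \<tau>: "Transposition.transpose t j permutes {..<n}"
    using assms by (intro permutes_swap_id) auto
  have "(\<integral>\<^sup>+ \<omega>. u (price \<omega> t i) \<partial>bandit_space k n F)
      = (\<integral>\<^sup>+ (X, \<sigma>). u (X (i, \<sigma> i t)) \<partial>bandit_space k n F)"
    by (intro nn_integral_cong) (auto simp: price_def)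
  also have "\<dots> = (\<Sum>\<sigma> | \<sigma> permutes {..<n}. \<integral>\<^sup>+ X. u (X (i, \<sigma> t)) \<partial>prices) / of_nat (fact n)"
  proof (rule nn_integral_bandit_space[OF \<open>i < k\<close>])
    have "(\<lambda>\<omega>. u (price \<omega> t i)) \<in> borel_measurable (bandit_space k n F)"
      using \<open>i < k\<close> by measurable
    then show "(\<lambda>(X, \<sigma>). u (X (i, \<sigma> i t))) \<in> borel_measurable (bandit_space k n F)"
      by (simp add: price_def case_prod_beta')
  qed
  also have "(\<Sum>\<sigma> | \<sigma> permutes {..<n}. \<integral>\<^sup>+ X. u (X (i, \<sigma> t)) \<partial>prices) = \<top>"
    using \<tau> assms nn_integral_price_single[of i j u]
    by (auto simp: ennreal_sum_eq_top finite_permutations intro!: exI[of _ "Transposition.transpose t j"])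
  also have "\<top> / of_nat (fact n) = (\<top> :: ennreal)"
    by (simp add: ennreal_top_divide)
  finally show ?thesis .
qed

end

section \<open>Trading a single type\<close>

lemma profit_Suc:
  "profit (Suc m) p h =
    (\<Sum>t<m. position_price (p (Suc t)) (h t) - position_price (p t) (h t)) - position_price (p m) (h m)"
proof -
  \<comment> \<open>The position before period 0 is \<open>None\<close>, of price 0, so the first
    term drops out and the rest shifts by one period.\<close>
  have "(\<Sum>t<Suc m. position_price (p t) (previous h t)) = (\<Sum>t<m. position_price (p (Suc t)) (h t))"
    by (subst sum.lessThan_Suc_shift) (simp add: previous_def position_price_def)
  then show ?thesis
    by (simp add: profit_def sum_subtractf)
qed

lemma finite_position_sequences: "finite ({..<n :: nat} \<rightarrow>\<^sub>E positions k)"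
  by (intro finite_PiE) (auto simp: positions_def)

lemma OPT_nonneg: "0 \<le> OPT k n p"
proof -
  let ?h = "\<lambda>t\<in>{..<n}. None :: position"
  have "previous ?h t = None" if "t < n" for t
    using that by (auto simp: previous_def split: nat.split)
  then have "profit n p ?h = 0"
    by (simp add: profit_def position_price_def)
  moreover have "?h \<in> {..<n} \<rightarrow>\<^sub>E positions k"
    by (auto simp: positions_def)
  ultimately show ?thesis
    unfolding OPT_def using finite_position_sequences by (metis Max_ge finite_imageI imageI)
qed

lemma OPT_0: "OPT k 0 p = 0"
  by (simp add: OPT_def profit_def)

text \<open>At most one type is held at a time, so the increment collected is at most the sum of the
  positive parts over all types. The last increment leads to the price 0, since an item left over is
  worthless.\<close>

lemma OPT_Suc_le:
  "OPT k (Suc m) p \<le> (\<Sum>i<k. (\<Sum>t<m. max 0 (p (Suc t) i - p t i)) + max 0 (- p m i))"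
proof -
  have one: "f i \<le> (\<Sum>i<k. max 0 (f i))" if "i < k" for i and f :: "nat \<Rightarrow> real"
    using that member_le_sum[of i "{..<k}" "\<lambda>i. max 0 (f i)"] by auto
  have step: "position_price q a - position_price r a \<le> (\<Sum>i<k. max 0 (q i - r i))"
    if "a \<in> positions k" for q r a
    using that one[of _ "\<lambda>i. q i - r i"]
    by (auto simp: positions_def position_price_def intro!: sum_nonneg)
  have "profit (Suc m) p h \<le> (\<Sum>i<k. (\<Sum>t<m. max 0 (p (Suc t) i - p t i)) + max 0 (- p m i))"
    if h: "h \<in> {..<Suc m} \<rightarrow>\<^sub>E positions k" for h
  proof -
    have h_mem: "h t \<in> positions k" if "t < Suc m" for t
      using PiE_mem[OF h] that by simp
    have "(\<Sum>t<m. position_price (p (Suc t)) (h t) - position_price (p t) (h t))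
        \<le> (\<Sum>t<m. \<Sum>i<k. max 0 (p (Suc t) i - p t i))"
      by (intro sum_mono step h_mem) simp
    moreover have "- position_price (p m) (h m) \<le> (\<Sum>i<k. max 0 (0 - p m i))"
      using step[OF h_mem[of m], of "\<lambda>_. 0" "p m"]
      by (cases "h m") (simp_all add: position_price_def)
    ultimately have "profit (Suc m) p h
        \<le> (\<Sum>t<m. \<Sum>i<k. max 0 (p (Suc t) i - p t i)) + (\<Sum>i<k. max 0 (0 - p m i))"
      unfolding profit_Suc by linarith
    also have "\<dots> = (\<Sum>i<k. (\<Sum>t<m. max 0 (p (Suc t) i - p t i)) + max 0 (- p m i))"
      by (simp add: sum.distrib sum.swap[of _ "{..<m}"])
    finally show ?thesis .
  qed
  then show ?thesis
    unfolding OPT_def using finite_position_sequences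
    by (intro Max.boundedI) (auto simp: PiE_eq_empty_iff positions_def)
qed

text \<open>\<open>S t\<close> is the set of prices at which type i is held in period t. Purchases
  and sales are implied by changes of position, so the policy needs no memory.\<close>

definition type_policy :: "nat \<Rightarrow> (nat \<Rightarrow> real set) \<Rightarrow> policy" where
  "type_policy i S t X = (if X (t, i) \<in> S t then Some i else None)"

lemma online_type_policy:
  assumes "i < k" and S: "\<And>t. S t \<in> sets borel"
  shows "online_policy k n (type_policy i S)"
  unfolding online_policy_def
proof (intro allI impI)
  fix t :: nat
  let ?M = "\<Pi>\<^sub>M _\<in>{..t} \<times> {..<k}. (borel :: real measure)"
  have "(\<lambda>X. X (t, i)) \<in> borel_measurable ?M"
    using assms by (intro measurable_component_singleton) auto
  from measurable_sets[OF this S] have "{X \<in> space ?M. X (t, i) \<in> S t} \<in> sets ?M"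
    by (simp add: vimage_def Int_def conj_commute)
  then show "type_policy i S t \<in> ?M \<rightarrow>\<^sub>M count_space (positions k)"
    unfolding type_policy_def[abs_def] using assms
    by (intro measurable_If) (auto simp: positions_def)
qed

lemma policy_profit_type_policy:
  assumes "i < k"
  shows "policy_profit k (Suc m) (type_policy i S) p
    = (\<Sum>t<m. indicator (S t) (p t i) * (p (Suc t) i - p t i)) - indicator (S m) (p m i) * p m i"
proof -
  have "position_price q (type_policy i S t (restrict (\<lambda>(s, i). p s i) ({..t} \<times> {..<k})))
      = indicator (S t) (p t i) * q i" for q t
    using assms by (simp add: type_policy_def position_price_def indicator_def)
  then show ?thesis
    unfolding policy_profit_def profit_Suc by (simp add: right_diff_distrib)
qed

text \<open>The positive part of f plus l equals g plus the negative part of f, and this identity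
  integrates without subtraction. The negative part is at most l, hence of finite mean, and the
  finite integral of l cancels; the integral of g and \<open>C\<close> may be infinite.\<close>

lemma ext_expectation_ge:
  fixes f g l :: "'a \<Rightarrow> real"
  assumes [measurable]: "g \<in> borel_measurable M" "l \<in> borel_measurable M"
    and f: "\<And>x. f x = g x - l x" and nonneg: "\<And>x. 0 \<le> g x" "\<And>x. 0 \<le> l x"
    and finite: "(\<integral>\<^sup>+ x. ennreal (l x) \<partial>M) < \<infinity>"
    and le: "(\<integral>\<^sup>+ x. ennreal (l x) \<partial>M) + C \<le> (\<integral>\<^sup>+ x. ennreal (g x) \<partial>M)"
  shows "quasi_integrable M f" "enn2ereal C \<le> ext_expectation M f"
proof -
  have "f = (\<lambda>x. g x - l x)" using f by auto
  then have [measurable]: "f \<in> borel_measurable M" by simp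
  let ?P = "\<integral>\<^sup>+ x. ennreal (f x) \<partial>M" and ?N = "\<integral>\<^sup>+ x. ennreal (- f x) \<partial>M"
  let ?G = "\<integral>\<^sup>+ x. ennreal (g x) \<partial>M" and ?L = "\<integral>\<^sup>+ x. ennreal (l x) \<partial>M"
  have "?N \<le> ?L"
    by (intro nn_integral_mono ennreal_leI) (simp add: f nonneg)
  then have N: "?N < \<infinity>" using finite by simp
  then show "quasi_integrable M f"
    by (simp add: quasi_integrable_def)
  have "ennreal (f x) + ennreal (l x) = ennreal (g x) + ennreal (- f x)" for x
  proof (cases "0 \<le> f x")
    case True
    then show ?thesis using f[of x] nonneg by (simp add: ennreal_neg flip: ennreal_plus)
  next
    case False
    then show ?thesis using f[of x] nonneg by (simp add: ennreal_neg flip: ennreal_plus)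
  qed
  then have "(\<integral>\<^sup>+ x. ennreal (f x) + ennreal (l x) \<partial>M) = (\<integral>\<^sup>+ x. ennreal (g x) + ennreal (- f x) \<partial>M)"
    by simp
  then have "?P + ?L = ?G + ?N"
    by (simp add: nn_integral_add)
  then have "?L + (C + ?N) \<le> ?L + ?P"
    using le add_right_mono[OF le, of ?N] by (simp add: ac_simps)
  then have CN: "C + ?N \<le> ?P"
    using finite by (auto simp: ennreal_add_left_cancel_le)
  have "enn2ereal C + enn2ereal ?N \<le> enn2ereal ?P"
    using CN by (simp flip: plus_ennreal.rep_eq add: less_eq_ennreal.rep_eq)
  moreover have "\<bar>enn2ereal ?N\<bar> \<noteq> \<infinity>"
    using N by (cases ?N) auto
  ultimately show "enn2ereal C \<le> ext_expectation M f"
    unfolding ext_expectation_def by (simp add: ereal_le_minus)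
qed

lemma ennreal_diff_le_split: "ennreal (y - x) \<le> ennreal (y - c) + ennreal (c - x)"
proof -
  have "ennreal (y - x) \<le> ennreal (max 0 (y - c) + max 0 (c - x))"
    by (intro ennreal_leI) auto
  then show ?thesis by simp
qed

section \<open>Expected gains and losses over one step\<close>

context bandit
begin

lemma expected_OPT_eq:
  "expected_OPT k n F = enn2ereal (\<integral>\<^sup>+ \<omega>. ennreal (OPT k n (price \<omega>)) \<partial>bandit_space k n F)"
  using OPT_nonneg by (simp add: expected_OPT_def ext_expectation_def ennreal_neg zero_ennreal.rep_eq)

text \<open>An average over the equally likely pairs (j, l) of laws in two periods; for every level
  c it bounds the expected positive part of an increment. \<open>threshold_gain\<close> and
  \<open>threshold_loss\<close> average in the same way what holding at prices up to c gains and
  loses.\<close>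

definition split_bound :: "nat \<Rightarrow> real \<Rightarrow> ennreal" where
  "split_bound i c =
    (\<Sum>j<n. \<Sum>l\<in>{..<n} - {j}. upper_part (F i l) c + lower_part (F i j) c) / of_nat (n * (n - 1))"

definition threshold_gain :: "nat \<Rightarrow> real \<Rightarrow> ennreal" where
  "threshold_gain i c =
    (\<Sum>j<n. \<Sum>l\<in>{..<n} - {j}.
      ennreal (cdf (F i j) c) * upper_part (F i l) c + lower_part (F i j) c) / of_nat (n * (n - 1))"

definition threshold_loss :: "nat \<Rightarrow> real \<Rightarrow> ennreal" where
  "threshold_loss i c =
    (\<Sum>j<n. \<Sum>l\<in>{..<n} - {j}. ennreal (cdf (F i j) c) * lower_part (F i l) c) / of_nat (n * (n - 1))"

lemma ex_threshold_gain:
  assumes "i < k"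
  obtains c c' where
    "threshold_loss i c + ennreal (trading_ratio n) * split_bound i c' \<le> threshold_gain i c"
proof (rule ex_good_threshold[of n "F i", OF real_distribution_F[OF assms] isCont_cdf_F[OF assms]])
  fix c c'
  assume "(\<Sum>j<n. \<Sum>l\<in>{..<n} - {j}. ennreal (cdf (F i j) c) * lower_part (F i l) c)
      + ennreal (trading_ratio n) *
        (\<Sum>j<n. \<Sum>l\<in>{..<n} - {j}. upper_part (F i l) c' + lower_part (F i j) c')
      \<le> (\<Sum>j<n. \<Sum>l\<in>{..<n} - {j}.
          ennreal (cdf (F i j) c) * upper_part (F i l) c + lower_part (F i j) c)"
  from divide_right_mono_ennreal[OF this, of "of_nat (n * (n - 1))"] show thesis
    by (intro that[of c c'])
       (simp only: threshold_loss_def split_bound_def threshold_gain_def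
         add_divide_distrib_ennreal ennreal_times_divide)
qed auto

lemma threshold_loss_finite:
  assumes "i < k" "n \<ge> 2" "\<And>j. j < n \<Longrightarrow> lower_part (F i j) 0 < \<top>"
  shows "threshold_loss i c < \<top>"
proof -
  have "lower_part (F i l) c < \<top>" if "l < n" for l
    using real_distribution.lower_part_finite[OF real_distribution_F, of i l 0 c] assms that by simp
  then have "(\<Sum>j<n. \<Sum>l\<in>{..<n} - {j}. ennreal (cdf (F i j) c) * lower_part (F i l) c) < \<top>"
    by (simp add: ennreal_mult_less_top)
  moreover have "(of_nat (n * (n - 1)) :: ennreal) \<noteq> 0"
    using assms(2) by auto
  ultimately show ?thesis
    unfolding threshold_loss_def less_top[symmetric] ennreal_divide_eq_top_iff by auto
qed

lemma nn_integral_one_F: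
  assumes "i < k" "j < n"
  shows "(\<integral>\<^sup>+ x. 1 \<partial>F i j) = 1"
proof -
  interpret real_distribution "F i j" using assms by (rule real_distribution_F)
  show ?thesis by (simp only: nn_integral_const emeasure_space_1 mult_1)
qed

lemma nn_integral_indicator_F:
  assumes "i < k" "j < n"
  shows "(\<integral>\<^sup>+ x. indicator {..c} x \<partial>F i j) = ennreal (cdf (F i j) c)"
proof -
  interpret real_distribution "F i j" using assms by (rule real_distribution_F)
  show ?thesis by (simp add: cdf_def emeasure_eq_measure)
qed

text \<open>The term in \<open>w\<close> is paired with the constant 1, so that it is averaged over
  the same pairs as the product.\<close>

lemma nn_integral_sum_prices:
  assumes "i < k" "t < n" "s < n" "t \<noteq> s"
    and [measurable]: "u \<in> borel_measurable borel" "v \<in> borel_measurable borel" "w \<in> borel_measurable borel"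
  shows "(\<integral>\<^sup>+ \<omega>. u (price \<omega> t i) * v (price \<omega> s i) + w (price \<omega> t i) \<partial>bandit_space k n F)
    = (\<Sum>j<n. \<Sum>l\<in>{..<n} - {j}. (\<integral>\<^sup>+ x. u x \<partial>F i j) * (\<integral>\<^sup>+ x. v x \<partial>F i l) + (\<integral>\<^sup>+ x. w x \<partial>F i j))
      / of_nat (n * (n - 1))"
proof -
  have [measurable]: "(\<lambda>\<omega>. price \<omega> t i) \<in> borel_measurable (bandit_space k n F)" for t
    using assms(1) by (rule measurable_price)
  have "(\<integral>\<^sup>+ \<omega>. u (price \<omega> t i) * v (price \<omega> s i) + w (price \<omega> t i) \<partial>bandit_space k n F)
      = (\<integral>\<^sup>+ \<omega>. u (price \<omega> t i) * v (price \<omega> s i) \<partial>bandit_space k n F)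
        + (\<integral>\<^sup>+ \<omega>. w (price \<omega> t i) * 1 \<partial>bandit_space k n F)"
    unfolding mult_1_right by (intro nn_integral_add) measurable
  also have "\<dots> = (\<Sum>j<n. \<Sum>l\<in>{..<n} - {j}. (\<integral>\<^sup>+ x. u x \<partial>F i j) * (\<integral>\<^sup>+ x. v x \<partial>F i l)) / of_nat (n * (n - 1))
      + (\<Sum>j<n. \<Sum>l\<in>{..<n} - {j}. (\<integral>\<^sup>+ x. w x \<partial>F i j) * (\<integral>\<^sup>+ x. 1 \<partial>F i l)) / of_nat (n * (n - 1))"
    by (intro arg_cong2[where f = "(+)"] nn_integral_price_steps[OF assms(1-4)]
        nn_integral_price_steps[OF assms(1-4), where v = "\<lambda>_. 1"] assms borel_measurable_const)
  also have "(\<Sum>j<n. \<Sum>l\<in>{..<n} - {j}. (\<integral>\<^sup>+ x. w x \<partial>F i j) * (\<integral>\<^sup>+ x. 1 \<partial>F i l))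
      = (\<Sum>j<n. \<Sum>l\<in>{..<n} - {j}. (\<integral>\<^sup>+ x. w x \<partial>F i j))"
    by (intro sum.cong refl) (simp only: nn_integral_one_F assms(1) Diff_iff lessThan_iff mult_1_right)
  finally show ?thesis
    by (simp only: sum.distrib add_divide_distrib_ennreal)
qed

context
  fixes i t s :: nat
  assumes i: "i < k" and ts: "t < n" "s < n" "t \<noteq> s"
begin

lemma nn_integral_step_le_split_bound:
  "(\<integral>\<^sup>+ \<omega>. ennreal (price \<omega> s i - price \<omega> t i) \<partial>bandit_space k n F) \<le> split_bound i c"
proof -
  have "(\<integral>\<^sup>+ \<omega>. ennreal (price \<omega> s i - price \<omega> t i) \<partial>bandit_space k n F)
      \<le> (\<integral>\<^sup>+ \<omega>. 1 * ennreal (price \<omega> s i - c) + ennreal (c - price \<omega> t i) \<partial>bandit_space k n F)"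
    unfolding mult_1 by (intro nn_integral_mono ennreal_diff_le_split)
  also have "\<dots> = (\<Sum>j<n. \<Sum>l\<in>{..<n} - {j}. (\<integral>\<^sup>+ x. 1 \<partial>F i j) * upper_part (F i l) c + lower_part (F i j) c)
      / of_nat (n * (n - 1))"
    by (rule nn_integral_sum_prices[OF i ts]) measurable
  also have "\<dots> = split_bound i c"
    unfolding split_bound_def
    by (intro sum.cong refl arg_cong2[where f = "(/)"]) (simp only: nn_integral_one_F i lessThan_iff mult_1)
  finally show ?thesis .
qed

lemma nn_integral_threshold_gain:
  "(\<integral>\<^sup>+ \<omega>. indicator {..c} (price \<omega> t i) * ennreal (price \<omega> s i - c) + ennreal (c - price \<omega> t i)
    \<partial>bandit_space k n F) = threshold_gain i c"
proof -
  have "(\<integral>\<^sup>+ \<omega>. indicator {..c} (price \<omega> t i) * ennreal (price \<omega> s i - c) + ennreal (c - price \<omega> t i)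
      \<partial>bandit_space k n F)
    = (\<Sum>j<n. \<Sum>l\<in>{..<n} - {j}. (\<integral>\<^sup>+ x. indicator {..c} x \<partial>F i j) * upper_part (F i l) c + lower_part (F i j) c)
      / of_nat (n * (n - 1))"
    by (rule nn_integral_sum_prices[OF i ts]) measurable
  also have "\<dots> = threshold_gain i c"
    unfolding threshold_gain_def
    by (intro sum.cong refl arg_cong2[where f = "(/)"]) (simp only: nn_integral_indicator_F i lessThan_iff)
  finally show ?thesis .
qed

lemma nn_integral_threshold_loss:
  "(\<integral>\<^sup>+ \<omega>. indicator {..c} (price \<omega> t i) * ennreal (c - price \<omega> s i) \<partial>bandit_space k n F)
    = threshold_loss i c"
proof -
  have "(\<integral>\<^sup>+ \<omega>. indicator {..c} (price \<omega> t i) * ennreal (c - price \<omega> s i) \<partial>bandit_space k n F)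
    = (\<Sum>j<n. \<Sum>l\<in>{..<n} - {j}. (\<integral>\<^sup>+ x. indicator {..c} x \<partial>F i j) * lower_part (F i l) c)
      / of_nat (n * (n - 1))"
    by (rule nn_integral_price_steps[OF i ts]) measurable
  also have "\<dots> = threshold_loss i c"
    unfolding threshold_loss_def
    by (intro sum.cong refl arg_cong2[where f = "(/)"]) (simp only: nn_integral_indicator_F i lessThan_iff)
  finally show ?thesis .
qed

end

section \<open>A good policy for at least one period\<close>

context
  fixes m :: nat
  assumes n: "n = Suc m"
begin

text \<open>The expected optimum with full knowledge when only type i may be traded: it is held
  exactly before a rise, the price after the last period being 0.\<close>

definition type_optimum :: "nat \<Rightarrow> ennreal" where
  "type_optimum i = (\<integral>\<^sup>+ \<omega>. (\<Sum>t<m. ennreal (price \<omega> (Suc t) i - price \<omega> t i))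
    + ennreal (- price \<omega> m i) \<partial>bandit_space k n F)"

lemma nn_integral_OPT_le:
  "(\<integral>\<^sup>+ \<omega>. ennreal (OPT k n (price \<omega>)) \<partial>bandit_space k n F) \<le> (\<Sum>i<k. type_optimum i)"
proof -
  have [measurable]: "(\<lambda>\<omega>. price \<omega> t i) \<in> borel_measurable (bandit_space k n F)" if "i < k" for i t
    using that by (rule measurable_price)
  let ?T = "\<lambda>i \<omega>. (\<Sum>t<m. ennreal (price \<omega> (Suc t) i - price \<omega> t i)) + ennreal (- price \<omega> m i)"
  have "ennreal (OPT k n (price \<omega>)) \<le> (\<Sum>i<k. ?T i \<omega>)" for \<omega>
  proof -
    have "ennreal (OPT k n (price \<omega>)) \<le> ennreal (\<Sum>i<k. (\<Sum>t<m. max 0 (price \<omega> (Suc t) i - price \<omega> t i))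
        + max 0 (- price \<omega> m i))"
      unfolding n by (intro ennreal_leI OPT_Suc_le)
    then show ?thesis
      by (simp add: sum_nonneg flip: sum_ennreal)
  qed
  then have "(\<integral>\<^sup>+ \<omega>. ennreal (OPT k n (price \<omega>)) \<partial>bandit_space k n F)
      \<le> (\<integral>\<^sup>+ \<omega>. (\<Sum>i<k. ?T i \<omega>) \<partial>bandit_space k n F)"
    by (intro nn_integral_mono)
  also have "\<dots> = (\<Sum>i<k. type_optimum i)"
    unfolding type_optimum_def by (intro nn_integral_sum) auto
  finally show ?thesis .
qed

lemma type_optimum_le:
  assumes "i < k"
  shows "type_optimum i \<le> of_nat m * split_bound i c
    + (\<integral>\<^sup>+ \<omega>. ennreal (- price \<omega> m i) \<partial>bandit_space k n F)"
proof -
  have [measurable]: "(\<lambda>\<omega>. price \<omega> t i) \<in> borel_measurable (bandit_space k n F)" for t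
    using assms by (rule measurable_price)
  have "type_optimum i = (\<integral>\<^sup>+ \<omega>. (\<Sum>t<m. ennreal (price \<omega> (Suc t) i - price \<omega> t i)) \<partial>bandit_space k n F)
      + (\<integral>\<^sup>+ \<omega>. ennreal (- price \<omega> m i) \<partial>bandit_space k n F)"
    unfolding type_optimum_def by (intro nn_integral_add) measurable
  also have "(\<integral>\<^sup>+ \<omega>. (\<Sum>t<m. ennreal (price \<omega> (Suc t) i - price \<omega> t i)) \<partial>bandit_space k n F)
      = (\<Sum>t<m. \<integral>\<^sup>+ \<omega>. ennreal (price \<omega> (Suc t) i - price \<omega> t i) \<partial>bandit_space k n F)"
    by (intro nn_integral_sum) measurable
  also have "(\<Sum>t<m. \<integral>\<^sup>+ \<omega>. ennreal (price \<omega> (Suc t) i - price \<omega> t i) \<partial>bandit_space k n F)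
      \<le> (\<Sum>t<m. split_bound i c)"
    using assms n by (intro sum_mono nn_integral_step_le_split_bound) auto
  finally show ?thesis by simp
qed

text \<open>The factor 1/k is lost here: a sum over k types is at most k times its largest
  term.\<close>

lemma ex_best_type:
  assumes "k \<ge> 1"
  obtains i where "i < k"
    "(\<integral>\<^sup>+ \<omega>. ennreal (OPT k n (price \<omega>)) \<partial>bandit_space k n F) \<le> of_nat k * type_optimum i"
proof -
  have "Max (type_optimum ` {..<k}) \<in> type_optimum ` {..<k}"
    using assms by (intro Max_in) (auto simp: lessThan_empty_iff)
  then obtain i where i: "i < k" "type_optimum i = Max (type_optimum ` {..<k})" by auto
  have "(\<Sum>i<k. type_optimum i) \<le> of_nat (card {..<k}) * type_optimum i"
    unfolding i(2) by (intro sum_bounded_above) auto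
  then show thesis
    using i(1) nn_integral_OPT_le by (intro that[of i]) auto
qed

text \<open>At a price up to c, the increment is the distance down from c now, plus the upper part
  of the next price, minus its lower part; above c every contribution is 0. Summing gives profit
  \<open>g\<close> - \<open>l\<close> with nonnegative \<open>g\<close> and \<open>l\<close>. The
  last period uses threshold 0, as an item bought then is never sold.\<close>

lemma type_policy_threshold:
  assumes "i < k" "\<And>j. j < n \<Longrightarrow> lower_part (F i j) 0 < \<top>"
    and le: "of_nat m * threshold_loss i c + C
      \<le> of_nat m * threshold_gain i c + (\<integral>\<^sup>+ \<omega>. ennreal (- price \<omega> m i) \<partial>bandit_space k n F)"
  defines "\<pi> \<equiv> type_policy i (\<lambda>t. if t = m then {..0} else {..c})"
  shows "quasi_integrable (bandit_space k n F) (\<lambda>\<omega>. policy_profit k n \<pi> (price \<omega>))"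
    and "enn2ereal C \<le> expected_profit k n F \<pi>"
proof -
  let ?M = "bandit_space k n F"
  have [measurable]: "(\<lambda>\<omega>. price \<omega> t i) \<in> borel_measurable ?M" for t
    using assms(1) by (rule measurable_price)
  define g where "g \<omega> = (\<Sum>t<m. indicator {..c} (price \<omega> t i) * max 0 (price \<omega> (Suc t) i - c)
    + max 0 (c - price \<omega> t i)) + max 0 (- price \<omega> m i)" for \<omega>
  define l where "l \<omega> = (\<Sum>t<m. indicator {..c} (price \<omega> t i) * max 0 (c - price \<omega> (Suc t) i))" for \<omega>
  have [measurable]: "g \<in> borel_measurable ?M" "l \<in> borel_measurable ?M"
    unfolding g_def[abs_def] l_def[abs_def] by measurable
  have nonneg: "0 \<le> g \<omega>" "0 \<le> l \<omega>" for \<omega>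
    by (auto simp: g_def l_def intro!: sum_nonneg add_nonneg_nonneg)
  have "ennreal (g \<omega>) = (\<Sum>t<m. indicator {..c} (price \<omega> t i) * ennreal (price \<omega> (Suc t) i - c)
      + ennreal (c - price \<omega> t i)) + ennreal (- price \<omega> m i)" for \<omega>
    by (simp add: g_def sum_nonneg ennreal_mult ennreal_indicator flip: sum_ennreal)
  then have "(\<integral>\<^sup>+ \<omega>. ennreal (g \<omega>) \<partial>?M) = (\<integral>\<^sup>+ \<omega>. (\<Sum>t<m. indicator {..c} (price \<omega> t i) *
      ennreal (price \<omega> (Suc t) i - c) + ennreal (c - price \<omega> t i)) + ennreal (- price \<omega> m i) \<partial>?M)"
    by (simp only:)
  also have "\<dots> = (\<integral>\<^sup>+ \<omega>. (\<Sum>t<m. indicator {..c} (price \<omega> t i) *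
      ennreal (price \<omega> (Suc t) i - c) + ennreal (c - price \<omega> t i)) \<partial>?M) + (\<integral>\<^sup>+ \<omega>. ennreal (- price \<omega> m i) \<partial>?M)"
    by (intro nn_integral_add) measurable
  also have "(\<integral>\<^sup>+ \<omega>. (\<Sum>t<m. indicator {..c} (price \<omega> t i) *
      ennreal (price \<omega> (Suc t) i - c) + ennreal (c - price \<omega> t i)) \<partial>?M) = (\<Sum>t<m. \<integral>\<^sup>+ \<omega>. indicator {..c} (price \<omega> t i) *
      ennreal (price \<omega> (Suc t) i - c) + ennreal (c - price \<omega> t i) \<partial>?M)"
    by (intro nn_integral_sum) measurable
  also have "(\<Sum>t<m. \<integral>\<^sup>+ \<omega>. indicator {..c} (price \<omega> t i) *
      ennreal (price \<omega> (Suc t) i - c) + ennreal (c - price \<omega> t i) \<partial>?M) = (\<Sum>t<m. threshold_gain i c)"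
    using assms(1) n by (intro sum.cong nn_integral_threshold_gain) auto
  finally have g_int: "(\<integral>\<^sup>+ \<omega>. ennreal (g \<omega>) \<partial>?M)
      = of_nat m * threshold_gain i c + (\<integral>\<^sup>+ \<omega>. ennreal (- price \<omega> m i) \<partial>?M)"
    by simp
  have "ennreal (l \<omega>) = (\<Sum>t<m. indicator {..c} (price \<omega> t i) * ennreal (c - price \<omega> (Suc t) i))" for \<omega>
    by (simp add: l_def sum_nonneg ennreal_mult ennreal_indicator flip: sum_ennreal)
  then have "(\<integral>\<^sup>+ \<omega>. ennreal (l \<omega>) \<partial>?M)
      = (\<integral>\<^sup>+ \<omega>. (\<Sum>t<m. indicator {..c} (price \<omega> t i) * ennreal (c - price \<omega> (Suc t) i)) \<partial>?M)"
    by (simp only:)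
  also have "\<dots> = (\<Sum>t<m. \<integral>\<^sup>+ \<omega>. indicator {..c} (price \<omega> t i) * ennreal (c - price \<omega> (Suc t) i) \<partial>?M)"
    by (intro nn_integral_sum) measurable
  also have "\<dots> = (\<Sum>t<m. threshold_loss i c)"
    using assms(1) n by (intro sum.cong nn_integral_threshold_loss) auto
  finally have l_int: "(\<integral>\<^sup>+ \<omega>. ennreal (l \<omega>) \<partial>?M) = of_nat m * threshold_loss i c"
    by simp
  have profit: "policy_profit k n \<pi> (price \<omega>) = g \<omega> - l \<omega>" for \<omega>
  proof -
    have "(\<Sum>t<m. indicator (if t = m then {..0} else {..c}) (price \<omega> t i) * (price \<omega> (Suc t) i - price \<omega> t i))
        = (\<Sum>t<m. indicator {..c} (price \<omega> t i) * max 0 (price \<omega> (Suc t) i - c)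
            + max 0 (c - price \<omega> t i) - indicator {..c} (price \<omega> t i) * max 0 (c - price \<omega> (Suc t) i))"
      by (intro sum.cong) (auto simp: indicator_def max_def)
    moreover have "indicator {..0} (price \<omega> m i) * price \<omega> m i = - max 0 (- price \<omega> m i)"
      by (simp add: indicator_def)
    ultimately show ?thesis
      unfolding \<pi>_def n policy_profit_type_policy[OF assms(1)] g_def l_def
      by (simp add: sum_subtractf)
  qed
  \<comment> \<open>With a single period \<open>l\<close> is an empty sum; finiteness of
    \<open>threshold_loss\<close> has been shown for n \<ge> 2.\<close>
  have fin: "(\<integral>\<^sup>+ \<omega>. ennreal (l \<omega>) \<partial>?M) < \<infinity>"
  proof (cases "m = 0")
    case False
    then have "threshold_loss i c < \<top>"
      using assms(1,2) n by (intro threshold_loss_finite) auto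
    then show ?thesis
      unfolding l_int by (simp add: ennreal_mult_less_top of_nat_less_top)
  qed (simp add: l_int)
  note * = ext_expectation_ge[where g = g and l = l, OF _ _ profit nonneg fin, unfolded l_int g_int, OF _ _ le]
  show "quasi_integrable ?M (\<lambda>\<omega>. policy_profit k n \<pi> (price \<omega>))"
    by (rule *(1)) measurable
  show "enn2ereal C \<le> expected_profit k n F \<pi>"
    unfolding expected_profit_def by (rule *(2)) measurable
qed

text \<open>Buying only at a nonpositive price in the last period never loses. Law j may be the one
  shown there, so the expected profit is infinite and exceeds any \<open>C\<close>.\<close>

lemma type_policy_last_period:
  assumes "i < k" "j < n" "lower_part (F i j) 0 = \<top>"
  defines "\<pi> \<equiv> type_policy i (\<lambda>t. if t = m then {..0} else {})"
  shows "quasi_integrable (bandit_space k n F) (\<lambda>\<omega>. policy_profit k n \<pi> (price \<omega>))"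
    and "enn2ereal C \<le> expected_profit k n F \<pi>"
proof -
  let ?M = "bandit_space k n F" and ?g = "\<lambda>\<omega>. max 0 (- price \<omega> m i)"
  have [measurable]: "(\<lambda>\<omega>. price \<omega> t i) \<in> borel_measurable ?M" for t
    using assms(1) by (rule measurable_price)
  have "(\<integral>\<^sup>+ \<omega>. ennreal (- price \<omega> m i) \<partial>?M) = \<top>"
    using assms(1-3) n by (intro nn_integral_price_eq_top[of i m j "\<lambda>x. ennreal (- x)"]) auto
  then have top: "(\<integral>\<^sup>+ \<omega>. ennreal 0 \<partial>?M) + C \<le> (\<integral>\<^sup>+ \<omega>. ennreal (?g \<omega>) \<partial>?M)"
    by simp
  have profit: "policy_profit k n \<pi> (price \<omega>) = ?g \<omega> - 0" for \<omega>
    unfolding \<pi>_def n policy_profit_type_policy[OF assms(1)] by (simp add: indicator_def)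
  note * = ext_expectation_ge[where g = ?g and l = "\<lambda>_. 0", OF _ _ profit _ _ _ top]
  show "quasi_integrable ?M (\<lambda>\<omega>. policy_profit k n \<pi> (price \<omega>))"
    by (rule *(1)) auto
  show "enn2ereal C \<le> expected_profit k n F \<pi>"
    unfolding expected_profit_def by (rule *(2)) auto
qed

lemma ex_policy_Suc:
  assumes k: "k \<ge> 1"
  obtains \<pi> where "online_policy k n \<pi>"
    "quasi_integrable (bandit_space k n F) (\<lambda>\<omega>. policy_profit k n \<pi> (price \<omega>))"
    "ereal (trading_ratio n / real k) * expected_OPT k n F \<le> expected_profit k n F \<pi>"
proof -
  let ?M = "bandit_space k n F" and ?\<rho> = "trading_ratio n"
  define E where "E = (\<integral>\<^sup>+ \<omega>. ennreal (OPT k n (price \<omega>)) \<partial>?M)"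
  have \<rho>: "0 \<le> ?\<rho>" "?\<rho> \<le> 1"
    using trading_ratio_bounds[of n] by auto
  \<comment> \<open>The target is moved to \<open>ennreal\<close>, where sums and products of
    possibly infinite terms are harmless.\<close>
  have target: "ereal (?\<rho> / real k) * expected_OPT k n F = enn2ereal (ennreal (?\<rho> / real k) * E)"
    using \<rho> by (simp add: expected_OPT_eq E_def times_ennreal.rep_eq enn2ereal_ennreal)
  show thesis
  proof (cases "\<exists>i<k. \<exists>j<n. lower_part (F i j) 0 = \<top>")
    case True
    then obtain i j where ij: "i < k" "j < n" "lower_part (F i j) 0 = \<top>" by blast
    show thesis
      using online_type_policy[OF ij(1)] type_policy_last_period[OF ij]
      by (intro that[unfolded target]) auto
  next
    case False
    obtain i where i: "i < k" and E: "E \<le> of_nat k * type_optimum i"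
      unfolding E_def by (rule ex_best_type[OF k])
    obtain c c' where c: "threshold_loss i c + ennreal ?\<rho> * split_bound i c' \<le> threshold_gain i c"
      by (rule ex_threshold_gain[OF i])
    define B where "B = (\<integral>\<^sup>+ \<omega>. ennreal (- price \<omega> m i) \<partial>?M)"
    have "ennreal (?\<rho> / real k) * E \<le> ennreal (?\<rho> / real k) * (of_nat k * type_optimum i)"
      using E by (intro mult_left_mono) auto
    also have "\<dots> = ennreal ?\<rho> * type_optimum i"
      using k \<rho> by (simp add: ennreal_of_nat_eq_real_of_nat flip: mult.assoc ennreal_mult)
    also have "\<dots> \<le> ennreal ?\<rho> * (of_nat m * split_bound i c' + B)"
      using type_optimum_le[OF i] unfolding B_def by (intro mult_left_mono) auto
    also have "\<dots> = of_nat m * (ennreal ?\<rho> * split_bound i c') + ennreal ?\<rho> * B"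
      by (simp only: distrib_left ac_simps)
    \<comment> \<open>The policy collects the last-period term \<open>B\<close> in full, so it
      suffices that the ratio is at most 1.\<close>
    also have "\<dots> \<le> of_nat m * (ennreal ?\<rho> * split_bound i c') + 1 * B"
      using \<rho> by (intro add_left_mono mult_right_mono) (auto simp: ennreal_le_1)
    \<comment> \<open>Adding the loss on both sides brings in the threshold inequality without
      subtracting.\<close>
    finally have "of_nat m * threshold_loss i c + ennreal (?\<rho> / real k) * E
        \<le> of_nat m * threshold_loss i c + (of_nat m * (ennreal ?\<rho> * split_bound i c') + 1 * B)"
      by (rule add_left_mono)
    also have "\<dots> = of_nat m * (threshold_loss i c + ennreal ?\<rho> * split_bound i c') + B"
      by (simp only: distrib_left ac_simps mult_1 mult_1_right)
    also have "\<dots> \<le> of_nat m * threshold_gain i c + B"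
      using c by (intro add_right_mono mult_left_mono) auto
    finally have main: "of_nat m * threshold_loss i c + ennreal (?\<rho> / real k) * E
        \<le> of_nat m * threshold_gain i c + B" .
    have "lower_part (F i j) 0 < \<top>" if "j < n" for j
      using False i that by (auto simp: less_top)
    from type_policy_threshold[OF i this main[unfolded B_def]] show thesis
      using online_type_policy[OF i]
      by (intro that[unfolded target]) auto
  qed
qed

end

lemma ex_policy:
  assumes "k \<ge> 1"
  shows "\<exists>\<pi>. online_policy k n \<pi> \<and>
    quasi_integrable (bandit_space k n F) (\<lambda>\<omega>. policy_profit k n \<pi> (price \<omega>)) \<and>
    ereal (trading_ratio n / real k) * expected_OPT k n F \<le> expected_profit k n F \<pi>"
proof (cases n)
  case 0
  \<comment> \<open>Without periods all profits and the optimum are 0.\<close>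
  then show ?thesis
    by (intro exI[of _ "\<lambda>_ _. None"])
       (simp add: online_policy_def quasi_integrable_def policy_profit_def profit_def
          expected_profit_def expected_OPT_def ext_expectation_def OPT_0)
next
  case (Suc m)
  show ?thesis
    by (rule ex_policy_Suc[OF Suc assms]) blast
qed

end

section \<open>One algorithm for both guarantees\<close>

theorem theorem5:
  fixes k :: nat
  assumes "k \<ge> 1"
  shows "\<exists>ALG\<^sub>1 ALG\<^sub>2. online_algorithm k ALG\<^sub>1 \<and> online_algorithm k ALG\<^sub>2 \<and>
    (\<forall>n F. bandit_instance k n F \<longrightarrow>
       expected_profit k n F (ALG\<^sub>1 n F) \<ge> ereal (1 / (16 * real k)) * expected_OPT k n F) \<and>
    (\<exists>\<epsilon> :: nat \<Rightarrow> real. \<epsilon> \<longlonglongrightarrow> 0 \<and>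
       (\<forall>n F. bandit_instance k n F \<longrightarrow>
          expected_profit k n F (ALG\<^sub>2 n F) \<ge> ereal (1 / (2 * real k) - \<epsilon> n) * expected_OPT k n F))"
proof -
  \<comment> \<open>The instance hypothesis stands under the existential, so that a policy can be
    chosen for all n and F at once.\<close>
  have "\<exists>\<pi>. bandit_instance k n F \<longrightarrow> online_policy k n \<pi> \<and>
      quasi_integrable (bandit_space k n F) (\<lambda>\<omega>. policy_profit k n \<pi> (price \<omega>)) \<and>
      ereal (trading_ratio n / real k) * expected_OPT k n F \<le> expected_profit k n F \<pi>" for n F
    using bandit.ex_policy[OF bandit.intro assms] by blast
  then obtain ALG where ALG: "\<And>n F. bandit_instance k n F \<Longrightarrow> online_policy k n (ALG n F) \<and>
      quasi_integrable (bandit_space k n F) (\<lambda>\<omega>. policy_profit k n (ALG n F) (price \<omega>)) \<and>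
      ereal (trading_ratio n / real k) * expected_OPT k n F \<le> expected_profit k n F (ALG n F)"
    by metis
  have online: "online_algorithm k ALG"
    using ALG by (simp add: online_algorithm_def)
  have "expected_profit k n F (ALG n F) \<ge> ereal (1 / (16 * real k)) * expected_OPT k n F"
    if inst: "bandit_instance k n F" for n F
  proof -
    \<comment> \<open>The ratio is at least 1/4, which more than covers 1/16.\<close>
    have "1 / 16 / real k \<le> trading_ratio n / real k"
      using trading_ratio_bounds(1)[of n] by (intro divide_right_mono) auto
    then have "ereal (1 / (16 * real k)) * expected_OPT k n F \<le> ereal (trading_ratio n / real k) * expected_OPT k n F"
      unfolding bandit.expected_OPT_eq[OF bandit.intro[OF inst]]
      by (intro ereal_mult_right_mono) auto
    also have "\<dots> \<le> expected_profit k n F (ALG n F)"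
      using ALG[OF inst] by simp
    finally show ?thesis .
  qed
  moreover have "\<exists>\<epsilon> :: nat \<Rightarrow> real. \<epsilon> \<longlonglongrightarrow> 0 \<and>
      (\<forall>n F. bandit_instance k n F \<longrightarrow>
        expected_profit k n F (ALG n F) \<ge> ereal (1 / (2 * real k) - \<epsilon> n) * expected_OPT k n F)"
  proof (intro exI conjI allI impI)
    \<comment> \<open>With this error the factor is exactly \<open>trading_ratio n / real k\<close>.
      It depends on n and k but not on \<open>F\<close>, so it is uniform over instances.\<close>
    show "(\<lambda>n. 1 / (2 * real k) - trading_ratio n / real k) \<longlonglongrightarrow> 0"
      using assms by (auto intro!: tendsto_eq_intros trading_ratio_tendsto)
  qed (use ALG in simp)
  ultimately show ?thesis
    using online by blast
qed

end
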